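(* Let $X$ be a zero-dimensional Hausdorff space and let $A_c(X)$ be a ring with $C_c^*(X)\subseteq A_c(X)\subsetneq C_c(X)$. Then there exists a maximal ideal $M$ in $A_c(X)$ which is not a $z^0$-ideal of $A_c(X)$ (and $M$ is then also a $z$-ideal in $A_c(X)$ which is not a $z^0$-ideal).
   Context: A space is zero-dimensional if its clopen sets form a base for its topology. $C_c(X)$ is the ring of real-valued continuous functions on $X$ with countable range, and $C_c^*(X)$ is the subring of bounded members of $C_c(X)$. Ideals are always proper. For a commutative reduced ring $R$ with unity and $a\in R$, let $M_a$ be the intersection of all maximal ideals of $R$ containing $a$, and $\mathcal P_a$ the intersection of all minimal prime ideals of $R$ containing $a$ (an empty intersection being $R$). An ideal $I$ of $R$ is a $z$-ideal if $M_a\subseteq I$ for every $a\in I$, and a $z^0$-ideal if $\mathcal P_a\subseteq I$ for every $a\in I$. *)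

theory Defs
  imports "HOL-Analysis.Analysis" "HOL-Algebra.Ideal" "HOL-Algebra.Subrings"
begin

definition zero_dimensional :: "'a::topological_space itself \<Rightarrow> bool" where
  "zero_dimensional _ \<longleftrightarrow> topological_basis {U :: 'a set. open U \<and> closed U}"

definition C_c :: "('a::topological_space \<Rightarrow> real) ring" where
  "C_c = \<lparr>carrier = {f. continuous_on UNIV f \<and> countable (range f)},
          mult = (\<lambda>f g x. f x * g x), one = (\<lambda>x. 1),
          zero = (\<lambda>x. 0), add = (\<lambda>f g x. f x + g x)\<rparr>"

definition C_c_star :: "('a::topological_space \<Rightarrow> real) set" where
  "C_c_star = {f \<in> carrier C_c. bounded (range f)}"

definition minimal_prime :: "'a set \<Rightarrow> ('a, 'b) ring_scheme \<Rightarrow> bool" where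
  "minimal_prime P R \<longleftrightarrow> primeideal P R \<and> (\<forall>Q. primeideal Q R \<and> Q \<subseteq> P \<longrightarrow> Q = P)"

(* Intersecting with the carrier gives the empty intersection the value R
   and changes nothing otherwise; likewise below. *)
definition M_of :: "('a, 'b) ring_scheme \<Rightarrow> 'a \<Rightarrow> 'a set" where
  "M_of R a = carrier R \<inter> \<Inter>{M. maximalideal M R \<and> a \<in> M}"

definition P_of :: "('a, 'b) ring_scheme \<Rightarrow> 'a \<Rightarrow> 'a set" where
  "P_of R a = carrier R \<inter> \<Inter>{P. minimal_prime P R \<and> a \<in> P}"

(* The locale ideal admits the whole ring, whereas ideals are proper here. *)
definition z_ideal :: "'a set \<Rightarrow> ('a, 'b) ring_scheme \<Rightarrow> bool" where
  "z_ideal I R \<longleftrightarrow> ideal I R \<and> I \<noteq> carrier R \<and> (\<forall>a\<in>I. M_of R a \<subseteq> I)"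

definition z0_ideal :: "'a set \<Rightarrow> ('a, 'b) ring_scheme \<Rightarrow> bool" where
  "z0_ideal I R \<longleftrightarrow> ideal I R \<and> I \<noteq> carrier R \<and> (\<forall>a\<in>I. P_of R a \<subseteq> I)"

lemma cring_C_c: "cring (C_c :: ('a::topological_space \<Rightarrow> real) ring)"
proof -
  have cnt: "countable (range (\<lambda>x. h (f x) (g x)))"
    if "countable (range f)" "countable (range g)"
    for f g :: "'a \<Rightarrow> real" and h :: "real \<Rightarrow> real \<Rightarrow> real"
  proof -
    have "countable ((\<lambda>(u, v). h u v) ` (range f \<times> range g))"
      using that by blast
    then show ?thesis
      by (rule countable_subset[rotated]) auto
  qed
  have closed: "(\<lambda>x. f x + g x) \<in> carrier C_c" "(\<lambda>x. f x * g x) \<in> carrier C_c"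
    if "f \<in> carrier C_c" "g \<in> carrier C_c" for f g :: "'a \<Rightarrow> real"
    using that cnt[of f g "(+)"] cnt[of f g "(*)"]
    by (simp_all add: C_c_def continuous_on_add continuous_on_mult)
  have const: "(\<lambda>x. c) \<in> carrier C_c" for c :: real
    by (simp add: C_c_def)
  have uminus: "(\<lambda>x. - f x) \<in> carrier C_c" if "f \<in> carrier C_c" for f :: "'a \<Rightarrow> real"
    using closed(2)[OF const[of "-1"] that] by simp
  have ops: "f \<otimes>\<^bsub>C_c\<^esub> g = (\<lambda>x. f x * g x)" "f \<oplus>\<^bsub>C_c\<^esub> g = (\<lambda>x. f x + g x)"
    "\<one>\<^bsub>C_c\<^esub> = (\<lambda>x. 1)" "\<zero>\<^bsub>C_c\<^esub> = (\<lambda>x. 0)" for f g :: "'a \<Rightarrow> real"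
    by (simp_all add: C_c_def)
  show ?thesis
  proof (rule cringI)
    show "abelian_group (C_c :: ('a \<Rightarrow> real) ring)"
    proof (rule abelian_groupI)
      fix f :: "'a \<Rightarrow> real" assume "f \<in> carrier C_c"
      then show "\<exists>g\<in>carrier C_c. g \<oplus>\<^bsub>C_c\<^esub> f = \<zero>\<^bsub>C_c\<^esub>"
        by (intro bexI[OF _ uminus]) (simp_all add: ops)
    qed (simp_all add: ops closed const algebra_simps)
    show "comm_monoid (C_c :: ('a \<Rightarrow> real) ring)"
      by (rule comm_monoidI) (simp_all add: ops closed const algebra_simps)
  qed (simp add: ops algebra_simps)
qed

end

(* For f in C_c but not in A, both h = 1/(1 + f^2) and f h are bounded, hence in A, while h is
   not a unit of A, since otherwise f = (f h)(1 + f^2) would lie in A. So some maximal ideal M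
   contains h. But h vanishes nowhere, hence is regular and lies in no minimal prime ideal;
   thus P_h = A is not contained in M. *)
theory Submission
  imports Defs "HOL-Algebra.Ring_Divisibility"
begin

text \<open>By Zorn's lemma. The set \<open>S\<close> is arbitrary so that one argument serves
  twice: \<open>{\<one>}\<close> leads to maximal ideals, a multiplicative set to prime
  ideals.\<close>

lemma (in ring) exists_ideal_maximal_disjoint:
  assumes I: "ideal I R" "I \<inter> S = {}"
  obtains J where "ideal J R" "I \<subseteq> J" "J \<inter> S = {}"
    and "\<And>K. \<lbrakk>ideal K R; J \<subseteq> K; K \<inter> S = {}\<rbrakk> \<Longrightarrow> K = J"
proof -
  let ?F = "{J. ideal J R \<and> I \<subseteq> J \<and> J \<inter> S = {}}"
  have "\<exists>J\<in>?F. \<forall>K\<in>?F. J \<subseteq> K \<longrightarrow> K = J"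
  proof (rule subset_Zorn_nonempty)
    fix C assume C: "C \<noteq> {}" "subset.chain ?F C"
    then have CF: "C \<subseteq> ?F" and "subset.chain {J. ideal J R} C"
      by (auto simp: subset_chain_def)
    from chain_Union_is_ideal[OF this(2)] have "ideal (\<Union>C) R"
      using C(1) by simp
    \<comment> \<open>Any one member of the nonempty chain already contains
      \<open>I\<close>.\<close>
    moreover have "I \<subseteq> \<Union>C" "\<Union>C \<inter> S = {}"
      using CF C(1) by blast+
    ultimately show "\<Union>C \<in> ?F" by simp
  qed (use I in auto)
  then obtain J where "J \<in> ?F" and max: "\<forall>K\<in>?F. J \<subseteq> K \<longrightarrow> K = J" by blast
  then have J: "ideal J R" "I \<subseteq> J" "J \<inter> S = {}" by simp_all
  moreover have "K = J" if "ideal K R" "J \<subseteq> K" "K \<inter> S = {}" for K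
    using max that J(2) by simp
  ultimately show thesis by (rule that)
qed

text \<open>An ideal is proper exactly when it misses \<open>\<one>\<close>, so an ideal maximal
  among those disjoint from \<open>{\<one>}\<close> is a maximal ideal. The principal ideal of
  \<open>h\<close> qualifies as a start, since \<open>\<one>\<close> as a multiple of
  \<open>h\<close> would make \<open>h\<close> a unit.\<close>

lemma (in cring) exists_maximalideal_containing:
  assumes h: "h \<in> carrier R" "h \<notin> Units R"
  obtains M where "maximalideal M R" "h \<in> M"
proof -
  have "PIdl h \<inter> {\<one>} = {}"
    using h by (auto simp: cgenideal_def Units_def m_comm)
  then obtain M where M: "ideal M R" "PIdl h \<subseteq> M" "M \<inter> {\<one>} = {}"
    and max: "\<And>K. \<lbrakk>ideal K R; M \<subseteq> K; K \<inter> {\<one>} = {}\<rbrakk> \<Longrightarrow> K = M"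
    using exists_ideal_maximal_disjoint[OF cgenideal_ideal[OF h(1)]] by metis
  have "maximalideal M R"
  proof (rule maximalidealI)
    show "carrier R \<noteq> M" using M(3) by auto
    show "K = M \<or> K = carrier R" if "ideal K R" "M \<subseteq> K" for K
      using max[OF that] ideal.one_imp_carrier[OF that(1)] by auto
  qed (fact M(1))
  moreover have "h \<in> M"
    using M(2) cgenideal_self[OF h(1)] by blast
  ultimately show thesis by (rule that)
qed

text \<open>Krull's argument: an ideal \<open>Q\<close> maximal among those disjoint from a
  multiplicative set is prime. If \<open>a\<close> and \<open>b\<close> lie outside
  \<open>Q\<close>, both enlarged ideals meet \<open>S\<close>; the product of the two witnesses
  stays in \<open>S\<close> but falls into \<open>Q\<close> as soon as \<open>a \<otimes> b\<close>
  does.\<close>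

lemma (in cring) exists_primeideal_disjoint:
  assumes S: "S \<subseteq> carrier R" "\<one> \<in> S" "\<And>s t. \<lbrakk>s \<in> S; t \<in> S\<rbrakk> \<Longrightarrow> s \<otimes> t \<in> S"
    and "\<zero> \<notin> S"
  obtains Q where "primeideal Q R" "Q \<inter> S = {}"
proof -
  have "{\<zero>} \<inter> S = {}" using \<open>\<zero> \<notin> S\<close> by simp
  then obtain Q where Q: "ideal Q R" "Q \<inter> S = {}"
    and max: "\<And>K. \<lbrakk>ideal K R; Q \<subseteq> K; K \<inter> S = {}\<rbrakk> \<Longrightarrow> K = Q"
    using exists_ideal_maximal_disjoint[OF zeroideal] by metis
  interpret Q: ideal Q R by (rule Q(1))
  \<comment> \<open>The ideal \<open>Q\<close> + (\<open>a\<close>) is strictly larger than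
    \<open>Q\<close>, so by maximality it meets \<open>S\<close>; its elements are written out for
    the computation below.\<close>
  have meets: "\<exists>q\<in>Q. \<exists>x\<in>carrier R. q \<oplus> x \<otimes> a \<in> S" if a: "a \<in> carrier R" "a \<notin> Q" for a
  proof -
    let ?K = "set_add R Q (PIdl a)"
    have K: "ideal ?K R"
      by (rule add_ideals[OF Q(1) cgenideal_ideal[OF a(1)]])
    have elts: "q \<oplus> x \<otimes> a \<in> ?K" if "q \<in> Q" "x \<in> carrier R" for q x
      using that by (auto simp: set_add_def' cgenideal_def)
    have "Q \<subseteq> ?K"
      using elts[of _ \<zero>] a(1) by auto
    moreover have "a \<in> ?K"
      using elts[of \<zero> \<one>] a(1) by simp
    ultimately have "?K \<inter> S \<noteq> {}"
      using max[OF K] a(2) by auto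
    then show ?thesis
      by (auto simp: set_add_def' cgenideal_def)
  qed
  have "primeideal Q R"
  proof (rule primeidealI)
    show "carrier R \<noteq> Q" using Q(2) S(1,2) by auto
    fix a b assume ab: "a \<in> carrier R" "b \<in> carrier R" "a \<otimes> b \<in> Q"
    show "a \<in> Q \<or> b \<in> Q"
    proof (rule ccontr)
      assume "\<not> (a \<in> Q \<or> b \<in> Q)"
      then obtain q x r y where q: "q \<in> Q" "x \<in> carrier R" "q \<oplus> x \<otimes> a \<in> S"
        and r: "r \<in> Q" "y \<in> carrier R" "r \<oplus> y \<otimes> b \<in> S"
        using meets ab(1,2) by meson
      note carr = q(2) r(2) Q.Icarr[OF q(1)] Q.Icarr[OF r(1)] ab(1,2)
      \<comment> \<open>The expansion is grouped into multiples of \<open>q\<close>,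
        \<open>r\<close> and \<open>a \<otimes> b\<close>, all three in \<open>Q\<close>.\<close>
      have "(q \<oplus> x \<otimes> a) \<otimes> (r \<oplus> y \<otimes> b) =
          (r \<oplus> y \<otimes> b) \<otimes> q \<oplus> ((x \<otimes> a) \<otimes> r \<oplus> (x \<otimes> y) \<otimes> (a \<otimes> b))"
        using carr by algebra
      also have "\<dots> \<in> Q"
        using carr Q.I_l_closed[OF q(1)] Q.I_l_closed[OF r(1)] Q.I_l_closed[OF ab(3)]
        by (intro Q.a_closed) auto
      finally show False
        using S(3)[OF q(3) r(3)] Q(2) by blast
    qed
  qed (rule Q(1), rule is_cring)
  then show thesis using Q(2) by (rule that)
qed

text \<open>If \<open>P\<close> contained \<open>h\<close>, adjoining the powers of \<open>h\<close>
  to the complement of \<open>P\<close> would lead to a strictly smaller prime. Regularity of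
  \<open>h\<close> is what keeps \<open>\<zero>\<close> out of the enlarged multiplicative
  set.\<close>

lemma (in cring) regular_notin_minimal_prime:
  assumes h: "h \<in> carrier R" "\<And>a. \<lbrakk>a \<in> carrier R; a \<otimes> h = \<zero>\<rbrakk> \<Longrightarrow> a = \<zero>"
    and P: "minimal_prime P R"
  shows "h \<notin> P"
proof
  assume "h \<in> P"
  from P have "primeideal P R" by (simp add: minimal_prime_def)
  then interpret P: primeideal P R .
  \<comment> \<open>Powers of a regular element are regular: one factor \<open>h\<close> is
    cancelled at a time.\<close>
  have pow: "a = \<zero>" if "a \<in> carrier R" "a \<otimes> h [^] n = \<zero>" for a and n :: nat
    using that
  proof (induction n)
    case (Suc n)
    have "a \<otimes> h [^] n \<in> carrier R" using h(1) Suc.prems(1) by simp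
    moreover have "(a \<otimes> h [^] n) \<otimes> h = \<zero>"
      using h(1) Suc.prems by (simp add: m_assoc)
    ultimately have "a \<otimes> h [^] n = \<zero>" by (rule h(2))
    then show ?case using Suc.IH Suc.prems(1) by blast
  qed simp
  \<comment> \<open>A prime avoiding these products is contained in \<open>P\<close> and misses \<open>h\<close>.\<close>
  define S where "S = {s \<otimes> h [^] n | s (n::nat). s \<in> carrier R - P}"
  have one: "\<one> \<in> carrier R - P"
    using P.one_imp_carrier P.I_notcarr by auto
  have elts: "s \<otimes> h [^] n \<in> S" if "s \<in> carrier R - P" for s and n :: nat
    using that by (auto simp: S_def)
  obtain Q where Q: "primeideal Q R" "Q \<inter> S = {}"
  proof (rule exists_primeideal_disjoint[of S])
    show "S \<subseteq> carrier R" using h(1) by (auto simp: S_def)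
    show "\<one> \<in> S" using elts[OF one, of 0] by simp
    show "\<zero> \<notin> S"
    proof
      assume "\<zero> \<in> S"
      then obtain s and n :: nat where "s \<in> carrier R - P" "s \<otimes> h [^] n = \<zero>"
        by (auto simp: S_def)
      then show False using pow[of s n] P.zero_closed by auto
    qed
    fix s t assume "s \<in> S" "t \<in> S"
    then obtain a b and m n :: nat where ab: "a \<in> carrier R - P" "b \<in> carrier R - P"
      and st: "s = a \<otimes> h [^] m" "t = b \<otimes> h [^] n"
      by (auto simp: S_def)
    have "s \<otimes> t = (a \<otimes> b) \<otimes> (h [^] m \<otimes> h [^] n)"
      unfolding st using ab h(1) by (simp add: m_ac)
    also have "\<dots> = (a \<otimes> b) \<otimes> h [^] (m + n)"
      using h(1) by (simp add: nat_pow_mult)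
    also have "\<dots> \<in> S"
      using ab P.I_prime by (intro elts) auto
    finally show "s \<otimes> t \<in> S" .
  qed (rule that)
  have "Q \<subseteq> P"
  proof
    fix x assume "x \<in> Q"
    moreover from this have "x \<in> carrier R"
      using ideal.Icarr[OF primeideal.axioms(1)[OF Q(1)]] by blast
    \<comment> \<open>Outside \<open>P\<close>, the element \<open>x\<close> would be in
      \<open>S\<close> with exponent 0.\<close>
    ultimately show "x \<in> P"
      using elts[of x 0] Q(2) by auto
  qed
  then have "Q = P" using P Q(1) by (simp add: minimal_prime_def)
  moreover have "h \<in> S" using elts[OF one, of 1] h(1) by simp
  ultimately show False using \<open>h \<in> P\<close> Q(2) by blast
qed

lemma C_c_simps:
  "f \<otimes>\<^bsub>C_c\<^esub> g = (\<lambda>x. f x * g x)" "f \<oplus>\<^bsub>C_c\<^esub> g = (\<lambda>x. f x + g x)"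
  "\<one>\<^bsub>C_c\<^esub> = (\<lambda>x. 1)" "\<zero>\<^bsub>C_c\<^esub> = (\<lambda>x. 0)"
  "f \<in> carrier C_c \<longleftrightarrow> continuous_on UNIV f \<and> countable (range f)"
  by (simp_all add: C_c_def)

text \<open>The range of the composite is the image of a countable set. This supplies members of
  \<open>A\<close> built from a function \<open>f\<close> that may be unbounded and outside
  \<open>A\<close>.\<close>

lemma compose_in_C_c_star:
  fixes f :: "'a::topological_space \<Rightarrow> real"
  assumes "f \<in> carrier C_c" "continuous_on UNIV g" "\<And>t. \<bar>g t\<bar> \<le> B"
  shows "(\<lambda>x. g (f x)) \<in> C_c_star"
proof -
  have "countable (range (\<lambda>x. g (f x)))"
    using countable_image[of "range f" g] assms(1) by (simp add: C_c_simps image_image)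
  moreover have "continuous_on UNIV (\<lambda>x. g (f x))"
    using assms(1) by (intro continuous_on_compose2[OF assms(2)]) (auto simp: C_c_simps)
  moreover have "bounded (range (\<lambda>x. g (f x)))"
    using assms(3) by (auto simp: bounded_iff)
  ultimately show ?thesis by (simp add: C_c_star_def C_c_simps)
qed

theorem theorem4p11:
  fixes A :: "('a::t2_space \<Rightarrow> real) set"
  assumes "zero_dimensional TYPE('a)"
    and "subring A C_c"
    and "C_c_star \<subseteq> A"
    and "A \<subset> carrier C_c"
  shows "\<exists>M. maximalideal M (C_c\<lparr>carrier := A\<rparr>)
           \<and> z_ideal M (C_c\<lparr>carrier := A\<rparr>)
           \<and> \<not> z0_ideal M (C_c\<lparr>carrier := A\<rparr>)"
proof -
  let ?R = "C_c\<lparr>carrier := A\<rparr>"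
  interpret C: cring "C_c :: ('a \<Rightarrow> real) ring" by (rule cring_C_c)
  interpret R: cring ?R
    using C.subcring_iff[of A] C.subcringI'[OF assms(2)] assms(4) by blast
  from assms(4) obtain f where f: "f \<in> carrier C_c" "f \<notin> A" by blast
  define h where "h = (\<lambda>x. 1 / (1 + (f x)\<^sup>2))"
  have pos: "1 + t\<^sup>2 > 0" for t :: real
    by (simp add: add_pos_nonneg)
  have hA: "h \<in> A"
    unfolding h_def
    by (rule subsetD[OF assms(3)], rule compose_in_C_c_star[OF f(1), where B = 1])
      (use pos in \<open>auto intro!: continuous_intros simp: less_imp_neq[symmetric] divide_simps\<close>)
  have fhA: "(\<lambda>x. f x / (1 + (f x)\<^sup>2)) \<in> A"
  proof (rule subsetD[OF assms(3)], rule compose_in_C_c_star[OF f(1), where B = 1])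
    show "continuous_on UNIV (\<lambda>t::real. t / (1 + t\<^sup>2))"
      using pos by (intro continuous_intros) (metis less_irrefl)
    fix t :: real
    \<comment> \<open>The right-hand side expands to
      \<open>t\<^sup>2 - \<bar>t\<bar> + 1\<close>.\<close>
    have "0 \<le> (\<bar>t\<bar> - 1)\<^sup>2 + \<bar>t\<bar>" by simp
    then have "\<bar>t\<bar> \<le> 1 + t\<^sup>2" by (simp add: power2_diff)
    then show "\<bar>t / (1 + t\<^sup>2)\<bar> \<le> 1"
      using pos[of t] by (simp add: abs_divide)
  qed
  have "h \<notin> Units ?R"
  proof
    assume "h \<in> Units ?R"
    then obtain g where g: "g \<in> A" "(\<lambda>x. g x * h x) = (\<lambda>x. 1)"
      by (auto simp: Units_def C_c_simps)
    \<comment> \<open>The inverse \<open>g\<close> must be \<open>1 + f\<^sup>2\<close> pointwise,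
      so this product of two members of \<open>A\<close> recovers \<open>f\<close>.\<close>
    have "f x / (1 + (f x)\<^sup>2) * g x = f x" for x
    proof -
      have "g x * h x = 1" using g(2) by meson
      then show ?thesis
        using pos[of "f x"] by (simp add: h_def divide_simps)
    qed
    then show False
      using R.m_closed[of "\<lambda>x. f x / (1 + (f x)\<^sup>2)" g] fhA g(1) f(2) by (simp add: C_c_simps)
  qed
  then obtain M where M: "maximalideal M ?R" "h \<in> M"
    using R.exists_maximalideal_containing[of h] hA by auto
  interpret M: maximalideal M ?R by (rule M(1))
  \<comment> \<open>For \<open>a\<close> in \<open>M\<close>, the ideal \<open>M\<close> is itself
    one of those intersected in \<open>M_of ?R a\<close>.\<close>
  have "z_ideal M ?R"
    using M(1) M.I_notcarr M.is_ideal by (auto simp: z_ideal_def M_of_def)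
  moreover have "h \<notin> P" if "minimal_prime P ?R" for P
  proof (rule R.regular_notin_minimal_prime[OF _ _ that])
    fix a assume "a \<otimes>\<^bsub>?R\<^esub> h = \<zero>\<^bsub>?R\<^esub>"
    then have "a x * h x = 0" for x by (simp add: C_c_simps fun_eq_iff)
    moreover have "h x \<noteq> 0" for x using pos[of "f x"] by (simp add: h_def)
    ultimately show "a = \<zero>\<^bsub>?R\<^esub>" by (simp add: C_c_simps fun_eq_iff)
  qed (use hA in simp)
  \<comment> \<open>The intersection is over the empty family, so only the carrier remains; it
    cannot fit into the proper ideal \<open>M\<close>.\<close>
  then have "P_of ?R h = carrier ?R" by (auto simp: P_of_def)
  then have "\<not> z0_ideal M ?R"
    using M(2) M.a_subset by (auto simp: z0_ideal_def)
  ultimately show ?thesis using M(1) by blast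
qed

end
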